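(* Let $d\in\mathbb N$ and let $(a_n)_{n\ge1}$ be a sequence of real numbers with $a_n\geq 0$ for all $n$ and $a_n\to\infty$ as $n\to\infty$. There exists a continuous, nonnegative, Lebesgue integrable function $f:\mathbb R^d\to\mathbb R$ such that $\limsup_{n\to\infty}a_nf(\sqrt[d]{n}\,x)=\infty$ for every $x\in\mathbb R^d$.
   Context: $\mathbb N=\{1,2,3,\dots\}$; integrability is with respect to the $d$-dimensional Lebesgue measure on $\mathbb R^d$. *)

theory Defs
  imports "HOL-Analysis.Analysis"
begin

end

theory Submission imports Defs begin

text \<open>
  Write \<open>d\<close> for the dimension and put \<open>s(x) = \<parallel>x\<parallel>\<^sup>d\<close>. Two facts reduce the problem to the half-line.
  The dilation of \<open>x\<close> by the \<open>d\<close>-th root of \<open>n\<close> multiplies \<open>s(x)\<close> by \<open>n\<close>, and the shell on which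
  \<open>s\<close> lies in an interval of length \<open>l\<close> has volume at most \<open>V l\<close>, where \<open>V\<close> is the volume
  of the unit ball, no matter how far out the interval is.

  On the half-line, every interval \<open>{M..M + k}\<close> contains a multiple \<open>n t\<close> of each \<open>t \<in> {0<..k}\<close>,
  and the least such \<open>n\<close> is at least \<open>M / k\<close>. So a single plateau over such an interval
  is hit by the multiples of all \<open>t \<le> k\<close> at once. Its height \<open>h\<^sub>k\<close> can be chosen first, so that
  \<open>k h\<^sub>k\<close> is summable; only then is the plateau pushed outwards, to \<open>M = k N\<^sub>k\<close> with
  \<open>h\<^sub>k a\<^sub>n \<ge> k\<close> for all \<open>n \<ge> N\<^sub>k\<close>, which costs nothing in the integral. The sum \<open>f\<close> of the plateaus
  is continuous by the Weierstrass test and integrable by the volume bound, and the plateau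
  number \<open>k\<close> provides some \<open>n \<ge> N\<^sub>k\<close> at which the sequence in question is at least \<open>k\<close>.
\<close>

section \<open>Plateaus on spherical shells\<close>

definition shell_bump :: "real \<Rightarrow> real \<Rightarrow> 'a::euclidean_space \<Rightarrow> real" where
  "shell_bump M L x = max 0 (min 1 (L + 1 - \<bar>norm x ^ DIM('a) - M\<bar>))"

lemma continuous_on_shell_bump: "continuous_on S (shell_bump M L)"
  unfolding shell_bump_def by (intro continuous_intros)

lemma shell_bump_nonneg: "0 \<le> shell_bump M L x"
  and shell_bump_le_1: "shell_bump M L x \<le> 1"
  by (auto simp: shell_bump_def)

lemma shell_bump_eq_1:
  fixes x :: "'a::euclidean_space"
  assumes "\<bar>norm x ^ DIM('a) - M\<bar> \<le> L"
  shows "shell_bump M L x = 1"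
  using assms by (simp add: shell_bump_def)

text \<open>
  The bound depends on the width of the bump but not on its position \<open>M\<close>: the support lies
  between two balls whose radii have \<open>d\<close>-th powers that differ by at most \<open>2 L + 2\<close>.
\<close>

lemma shell_bump_integrable_bound:
  fixes M L :: real
  assumes "M \<ge> 0" "L \<ge> 0"
  shows "integrable lborel (shell_bump M L :: 'a::euclidean_space \<Rightarrow> real)"
    and "(\<integral>x. shell_bump M L (x :: 'a) \<partial>lborel) \<le> unit_ball_vol DIM('a) * (2 * L + 2)"
proof -
  define d where "d = DIM('a)"
  have d: "d > 0" by (simp add: d_def)
  \<comment> \<open>The inner radius is truncated at 0, for the case that the shell is a full ball.\<close>
  define p where "p = max 0 (M - L - 1)"
  define q where "q = M + L + 1"
  have pq: "0 \<le> p" "p \<le> q" "0 \<le> q" "q - p \<le> 2 * L + 2"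
    using assms by (auto simp: p_def q_def)
  define A :: "'a set" where "A = cball 0 (root d q)"
  define B :: "'a set" where "B = ball 0 (root d p)"
  have ballvol: "measure lborel A = unit_ball_vol d * q" "measure lborel B = unit_ball_vol d * p"
    using pq d by (simp_all add: A_def B_def content_cball content_ball flip: d_def)
  have BA: "B \<subseteq> A"
  proof -
    have "root d p \<le> root d q" using pq d by simp
    then show ?thesis by (auto simp: A_def B_def)
  qed
  have fm: "A \<in> fmeasurable lborel" "B \<in> fmeasurable lborel"
    using emeasure_bounded_finite[of A] emeasure_bounded_finite[of B]
    by (auto simp: A_def B_def fmeasurable_def)
  have AB: "A - B \<in> fmeasurable lborel" using fm by (rule fmeasurable.Diff)
  have "measure lborel (A - B) = unit_ball_vol d * (q - p)"
    using measure_Diff[of lborel A B] fm BA ballvol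
    by (auto simp: fmeasurable_def right_diff_distrib)
  also have "\<dots> \<le> unit_ball_vol d * (2 * L + 2)"
    using pq by (intro mult_left_mono) auto
  finally have vol: "measure lborel (A - B) \<le> unit_ball_vol d * (2 * L + 2)" .
  have int: "integrable lborel (indicator (A - B) :: 'a \<Rightarrow> real)"
    using AB by (auto simp: fmeasurable_def)
  have le: "shell_bump M L x \<le> indicator (A - B) x" for x :: 'a
  proof (cases "x \<in> A - B")
    case True
    then show ?thesis using shell_bump_le_1 by simp
  next
    case False
    have "q < norm x ^ d" if "x \<notin> A"
    proof -
      have "root d q < norm x" using that by (simp add: A_def)
      then have "root d q ^ d < norm x ^ d" using pq d by (intro power_strict_mono) auto
      then show ?thesis using pq d by simp
    qed
    moreover have "norm x ^ d < p" if "x \<in> B"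
    proof -
      have "norm x < root d p" using that by (simp add: B_def)
      then have "norm x ^ d < root d p ^ d" using d by (intro power_strict_mono) auto
      then show ?thesis using pq d by simp
    qed
    moreover have "norm x ^ d \<ge> 0" by simp
    ultimately have "L + 1 \<le> \<bar>norm x ^ d - M\<bar>"
      using False by (auto simp: p_def q_def max_def split: if_splits)
    then show ?thesis by (simp add: shell_bump_def flip: d_def)
  qed
  have meas: "(shell_bump M L :: 'a \<Rightarrow> real) \<in> borel_measurable lborel"
    using borel_measurable_continuous_onI[OF continuous_on_shell_bump] by simp
  show int': "integrable lborel (shell_bump M L :: 'a \<Rightarrow> real)"
    by (rule Bochner_Integration.integrable_bound[OF int meas])
       (simp add: shell_bump_nonneg le)
  have "(\<integral>x. shell_bump M L (x :: 'a) \<partial>lborel) \<le> (\<integral>x. indicator (A - B) x \<partial>lborel)"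
    using int' int le by (intro integral_mono) auto
  also have "\<dots> = measure lborel (A - B)" by simp
  finally show "(\<integral>x. shell_bump M L (x :: 'a) \<partial>lborel) \<le> unit_ball_vol DIM('a) * (2 * L + 2)"
    using vol by (simp add: d_def)
qed

section \<open>Sums of plateaus\<close>

text \<open>
  The factor \<open>k + 1\<close> compensates the width of the bump number \<open>k\<close>, so that both the heights and
  the integrals of the summands are dominated by a geometric series.
\<close>

definition shell_sum :: "(nat \<Rightarrow> real) \<Rightarrow> 'a::euclidean_space \<Rightarrow> real" where
  "shell_sum M x = (\<Sum>k. 1 / (2 ^ k * (real k + 1)) * shell_bump (M k) (real k) x)"

lemma shell_summand_bounds:
  "0 \<le> 1 / (2 ^ k * (real k + 1)) * shell_bump (M k) (real k) x"
  "1 / (2 ^ k * (real k + 1)) * shell_bump (M k) (real k) x \<le> (1 / 2) ^ k"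
  "norm (1 / (2 ^ k * (real k + 1)) * shell_bump (M k) (real k) x) \<le> (1 / 2) ^ k"
proof -
  show "0 \<le> 1 / (2 ^ k * (real k + 1)) * shell_bump (M k) (real k) x"
    by (simp add: shell_bump_nonneg)
  have "1 / (2 ^ k * (real k + 1)) * shell_bump (M k) (real k) x \<le> 1 / (2 ^ k * 1) * 1"
    by (intro mult_mono divide_left_mono mult_left_mono)
       (auto simp: shell_bump_nonneg shell_bump_le_1)
  then show "1 / (2 ^ k * (real k + 1)) * shell_bump (M k) (real k) x \<le> (1 / 2) ^ k"
    by (simp add: power_one_over)
  then show "norm (1 / (2 ^ k * (real k + 1)) * shell_bump (M k) (real k) x) \<le> (1 / 2) ^ k"
    by (simp add: abs_mult shell_bump_nonneg)
qed

lemma summable_shell_summands: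
  "summable (\<lambda>k. 1 / (2 ^ k * (real k + 1)) * shell_bump (M k) (real k) x)"
  by (rule summable_comparison_test'[OF summable_geometric[of "1 / 2 :: real"]])
     (simp, rule shell_summand_bounds(3))

lemma shell_sum_nonneg: "0 \<le> shell_sum M x"
  unfolding shell_sum_def
  by (intro suminf_nonneg summable_shell_summands shell_summand_bounds)

lemma shell_sum_ge_on_plateau:
  fixes x :: "'a::euclidean_space"
  assumes "\<bar>norm x ^ DIM('a) - M k\<bar> \<le> real k"
  shows "1 / (2 ^ k * (real k + 1)) \<le> shell_sum M x"
proof -
  have "(\<Sum>i\<in>{k}. 1 / (2 ^ i * (real i + 1)) * shell_bump (M i) (real i) x) \<le> shell_sum M x"
    unfolding shell_sum_def
    by (intro sum_le_suminf summable_shell_summands shell_summand_bounds) auto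
  then show ?thesis using shell_bump_eq_1[OF assms] by simp
qed

lemma continuous_on_shell_sum: "continuous_on UNIV (shell_sum M :: 'a::euclidean_space \<Rightarrow> real)"
proof -
  have lim: "uniform_limit UNIV
      (\<lambda>n (x :: 'a). \<Sum>k<n. 1 / (2 ^ k * (real k + 1)) * shell_bump (M k) (real k) x)
      (shell_sum M) sequentially"
    unfolding shell_sum_def
    by (rule Weierstrass_m_test[where M = "\<lambda>k. (1 / 2) ^ k"])
       (rule shell_summand_bounds(3), simp)
  show ?thesis
    by (rule uniform_limit_theorem[OF _ lim])
       (auto intro!: always_eventually continuous_intros continuous_on_shell_bump
             simp del: times_divide_eq_left)
qed

lemma integrable_shell_sum:
  assumes "\<And>k. M k \<ge> 0"
  shows "integrable lborel (shell_sum M :: 'a::euclidean_space \<Rightarrow> real)"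
proof -
  let ?g = "\<lambda>k (x :: 'a). 1 / (2 ^ k * (real k + 1)) * shell_bump (M k) (real k) x"
  have int: "integrable lborel (?g k)" for k
    using assms by (intro integrable_mult_right shell_bump_integrable_bound(1)) auto
  have norm: "norm (?g k x) = ?g k x" for k x
    by (simp add: abs_mult shell_bump_nonneg)
  have bound: "(\<integral>x. norm (?g k x) \<partial>lborel) \<le> 2 * unit_ball_vol DIM('a) * (1 / 2) ^ k" for k
  proof -
    have "(\<integral>x. norm (?g k x) \<partial>lborel)
        = 1 / (2 ^ k * (real k + 1)) * (\<integral>x. shell_bump (M k) (real k) (x :: 'a) \<partial>lborel)"
      unfolding norm by (rule integral_mult_right_zero)
    also have "\<dots> \<le> 1 / (2 ^ k * (real k + 1)) * (unit_ball_vol DIM('a) * (2 * real k + 2))"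
      using assms by (intro mult_left_mono shell_bump_integrable_bound(2)) auto
    also have "\<dots> = 2 * unit_ball_vol DIM('a) * (1 / 2) ^ k"
      by (simp add: power_one_over divide_simps)
    finally show ?thesis .
  qed
  have summ: "summable (\<lambda>k. \<integral>x. norm (?g k x) \<partial>lborel)"
  proof (rule summable_comparison_test')
    show "summable (\<lambda>k. 2 * unit_ball_vol DIM('a) * (1 / 2) ^ k)"
      by (intro summable_mult summable_geometric) simp
    show "norm (\<integral>x. norm (?g k x) \<partial>lborel) \<le> 2 * unit_ball_vol DIM('a) * (1 / 2) ^ k"
      if "0 \<le> k" for k
      using bound[of k] Bochner_Integration.integral_nonneg[of lborel "\<lambda>x. norm (?g k x)"]
      by (simp del: norm_mult)
  qed
  show ?thesis
    unfolding shell_sum_def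
    by (rule integrable_suminf[OF int _ summ])
       (unfold norm, intro always_eventually allI summable_shell_summands)
qed

section \<open>Dilations by roots of natural numbers\<close>

lemma limsup_ereal_eq_PInfty:
  fixes X :: "nat \<Rightarrow> real"
  assumes "\<And>k. \<exists>n\<ge>k. real k \<le> X n"
  shows "limsup (\<lambda>n. ereal (X n)) = \<infinity>"
proof (rule ereal_top)
  fix B :: real
  show "ereal B \<le> limsup (\<lambda>n. ereal (X n))"
    unfolding limsup_INF_SUP
  proof (rule INF_greatest)
    fix m :: nat
    obtain n where n: "n \<ge> max m (nat \<lceil>B\<rceil>)" "real (max m (nat \<lceil>B\<rceil>)) \<le> X n"
      using assms by blast
    have "B \<le> real (nat \<lceil>B\<rceil>)" by (rule real_nat_ceiling_ge)
    also have "\<dots> \<le> X n" using n(2) by simp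
    finally show "ereal B \<le> (SUP n\<in>{m..}. ereal (X n))"
      using n(1) by (intro SUP_upper2[of n]) auto
  qed
qed

lemma multiple_in_interval:
  fixes t :: real and k N :: nat
  assumes "0 < t" "t \<le> real k"
  obtains n where "n \<ge> N" "real k * real N \<le> real n * t" "real n * t \<le> real k * real N + real k"
proof
  define n where "n = nat \<lceil>real k * real N / t\<rceil>"
  have n1: "real k * real N / t \<le> real n"
    unfolding n_def by (rule real_nat_ceiling_ge)
  have "0 \<le> real k * real N / t" using assms by simp
  then have n2: "real n \<le> real k * real N / t + 1"
    unfolding n_def by linarith
  show lower: "real k * real N \<le> real n * t"
    using n1 assms by (simp add: field_simps)
  have "real n * t \<le> real k * real N + t"
    using n2 assms by (simp add: field_simps)
  then show "real n * t \<le> real k * real N + real k" using assms by linarith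
  have "real k * real N \<le> real k * real n"
    using lower mult_right_mono[OF assms(2), of "real n"] by (simp add: mult.commute)
  then show "n \<ge> N" using assms by simp
qed

text \<open>
  The bump number 0 sits at the origin because \<open>k N\<^sub>k = 0\<close> for \<open>k = 0\<close>; it takes care of the point
  \<open>x = 0\<close>, which no dilation moves.
\<close>

lemma exists_integrable_limsup_dilations_infinite:
  fixes a :: "nat \<Rightarrow> real"
  assumes a: "filterlim a at_top sequentially"
  shows "\<exists>f :: 'a::euclidean_space \<Rightarrow> real.
    continuous_on UNIV f \<and> (\<forall>x. f x \<ge> 0) \<and> integrable lborel f \<and>
    (\<forall>x. limsup (\<lambda>n. ereal (a n * f (root DIM('a) (real n) *\<^sub>R x))) = \<infinity>)"
proof -
  have "\<exists>N\<ge>k. \<forall>n\<ge>N. real k * (2 ^ k * (real k + 1)) \<le> a n" for k :: nat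
  proof -
    obtain N where "\<forall>n\<ge>N. real k * (2 ^ k * (real k + 1)) \<le> a n"
      using a unfolding filterlim_at_top eventually_sequentially by blast
    then show ?thesis by (intro exI[of _ "max k N"]) auto
  qed
  then obtain N where Nk: "\<And>k. N k \<ge> k"
    and Na: "\<And>k n. n \<ge> N k \<Longrightarrow> real k * (2 ^ k * (real k + 1)) \<le> a n"
    by metis
  define M where "M k = real k * real (N k)" for k
  define f :: "'a \<Rightarrow> real" where "f = shell_sum M"
  have scale: "norm (root DIM('a) (real n) *\<^sub>R x) ^ DIM('a) = real n * norm x ^ DIM('a)"
    for n and x :: 'a
    by (simp add: power_mult_distrib)
  have large: "real k \<le> a n * f y"
    if "n \<ge> N k" "1 / (2 ^ k * (real k + 1)) \<le> f y" for n k y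
  proof -
    have "real k = (real k * (2 ^ k * (real k + 1))) * (1 / (2 ^ k * (real k + 1)))" by simp
    also have "\<dots> \<le> a n * f y"
    proof (rule mult_mono[OF Na[OF that(1)] that(2)])
      have "0 \<le> real k * (2 ^ k * (real k + 1))" by simp
      then show "0 \<le> a n" using Na[OF that(1)] by linarith
    qed simp
    finally show ?thesis .
  qed
  have "limsup (\<lambda>n. ereal (a n * f (root DIM('a) (real n) *\<^sub>R x))) = \<infinity>" for x
  proof (cases "x = 0")
    case True
    have "1 \<le> f 0"
      using shell_sum_ge_on_plateau[where x = "0 :: 'a" and M = M and k = 0]
      by (simp add: M_def f_def power_0_left)
    have "\<exists>n\<ge>k. real k \<le> a n * f (root DIM('a) (real n) *\<^sub>R x)" for k
    proof (intro exI conjI)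
      show "N k \<ge> k" by (rule Nk)
      have "1 / (2 ^ k * (real k + 1)) \<le> 1 / (1 * 1)"
        by (intro divide_left_mono mult_mono) auto
      also have "\<dots> \<le> f 0" using \<open>1 \<le> f 0\<close> by simp
      finally show "real k \<le> a (N k) * f (root DIM('a) (real (N k)) *\<^sub>R x)"
        using True by (intro large) auto
    qed
    then show ?thesis by (rule limsup_ereal_eq_PInfty)
  next
    case False
    define t where "t = norm x ^ DIM('a)"
    have "t > 0" using False by (simp add: t_def)
    have "\<exists>n\<ge>j. real j \<le> a n * f (root DIM('a) (real n) *\<^sub>R x)" for j
    proof -
      \<comment> \<open>The outer half \<open>{M k..M k + k}\<close> of a plateau is sure to contain a multiple of \<open>t\<close> if \<open>t \<le> k\<close>.\<close>
      define k where "k = max j (nat \<lceil>t\<rceil>)"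
      have "t \<le> real k" using real_nat_ceiling_ge[of t] by (simp add: k_def)
      then obtain n where n: "n \<ge> N k" "M k \<le> real n * t" "real n * t \<le> M k + real k"
        using multiple_in_interval[OF \<open>t > 0\<close>] unfolding M_def by blast
      have "1 / (2 ^ k * (real k + 1)) \<le> f (root DIM('a) (real n) *\<^sub>R x)"
        unfolding f_def
        by (rule shell_sum_ge_on_plateau)
           (unfold scale, use n in \<open>simp flip: t_def\<close>)
      then have "real k \<le> a n * f (root DIM('a) (real n) *\<^sub>R x)" using n(1) by (intro large)
      moreover have "j \<le> k" "j \<le> n" using n(1) Nk[of k] by (auto simp: k_def)
      ultimately show ?thesis by (intro exI[of _ n]) auto
    qed
    then show ?thesis by (rule limsup_ereal_eq_PInfty)
  qed
  moreover have "integrable lborel f"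
    unfolding f_def by (rule integrable_shell_sum) (simp add: M_def)
  ultimately show ?thesis
    using continuous_on_shell_sum[of M] shell_sum_nonneg[of M]
    by (intro exI[of _ f]) (auto simp: f_def)
qed

theorem theorem6:
  fixes a :: "nat \<Rightarrow> real"
  assumes "\<And>n. n \<ge> 1 \<Longrightarrow> a n \<ge> 0"
    and "filterlim a at_top sequentially"
  shows "\<exists>f :: real ^ 'd \<Rightarrow> real.
    continuous_on UNIV f \<and> (\<forall>x. f x \<ge> 0) \<and> integrable lebesgue f \<and>
    (\<forall>x. limsup (\<lambda>n. ereal (a n * f (root CARD('d) (real n) *\<^sub>R x))) = \<infinity>)"
proof -
  obtain f :: "real ^ 'd \<Rightarrow> real" where f: "continuous_on UNIV f" "\<forall>x. f x \<ge> 0"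
      "integrable lborel f"
      "\<forall>x. limsup (\<lambda>n. ereal (a n * f (root DIM(real ^ 'd) (real n) *\<^sub>R x))) = \<infinity>"
    using exists_integrable_limsup_dilations_infinite[OF assms(2)] by blast
  have "integrable lebesgue f"
    using f(3) by (simp add: integrable_completion)
  then show ?thesis using f by auto
qed

end
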